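(* Let $v:\mathrm{cl}\,G\to[0,1]$ be the function $$v(x)=\begin{cases}1, & x\in M_2^\varepsilon,\\ \tilde\sigma(x), & x\in \mathrm{cl}\,G\setminus M_2^\varepsilon.\end{cases}$$ Assume that for every $x_0\in G$ and every $p\in P$ there exists $q_0\in Q$ such that $$b\,(1-v(x_0))\ \ge\ -d^+v\bigl(x_0;f(x_0,p,q_0)\bigr).$$ Then $v$ is a subsolution of the Dirichlet problem $$\min_{p\in P}\max_{q\in Q}\langle \nabla u(x),f(x,p,q)\rangle+g(x)(1-u(x))=0,\quad x\in G;\qquad u(x)=\tilde\sigma(x),\quad x\in\partial G.$$
   Context: Setting. $P,Q$ are compact sets; $M_1,M_2\subset\mathbb{R}^d$ are closed sets with continuous boundaries $\mathcal M_1=\partial M_1$, $\mathcal M_2=\partial M_2$, at strictly positive distance from each other; $M_2$ may be empty. $G=\mathbb{R}^d\setminus(M_1\cup M_2)$, $\partial G=\mathcal M_1\cup\mathcal M_2$. Data: $f:\mathbb{R}^d\times P\times Q\to\mathbb{R}^d$, $g:\mathbb{R}^d\to\mathbb{R}$, $\sigma:\partial G\to[0,+\infty]$. Standing assumptions: (A1) $f,g$ are continuous and $\|f(x,p,q)\|\le R_f(1+\|x\|)$ for all $(x,p,q)$, for some constant $R_f$; (A2) $\|f(x+y,p,q)-f(x,p,q)\|+|g(x+y)-g(x)|\le\lambda\|y\|$ for all $x,y\in\mathbb{R}^d$, $p\in P$, $q\in Q$; (A3) $\min_{p\in P}\max_{q\in Q}\langle s,f(x,p,q)\rangle=\max_{q\in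 Q}\min_{p\in P}\langle s,f(x,p,q)\rangle$ for all $s,x\in\mathbb{R}^d$; (A4) there is a constant $b>0$ with $g(x)\ge b$ for all $x\in\mathbb{R}^d$; (A5) there is $\Sigma>0$ such that $\sigma(x)\in[0,\Sigma]$ for $x\in\mathcal M_1$, $\sigma(x)=+\infty$ for $x\in\mathcal M_2$, and $\sigma$ is Lipschitz continuous on $\mathcal M_1$ with some constant $L$. Extension of $\sigma$. $M_i^\varepsilon=\{x+y: x\in\mathcal M_i,\ \|y\|\le\varepsilon\}$. Fix $\varepsilon>0$ and an extension $\hat\sigma$ of $\sigma$ to $\mathrm{cl}\,G$ such that $\hat\sigma=\sigma$ on $\mathcal M_1$; $\hat\sigma$ is Lipschitz continuous with values in $[0,\Sigma]$ off $M_2^\varepsilon$; $\hat\sigma=+\infty$ on $M_2^\varepsilon$ (in particular $\mathcal M_1\cap M_2^\varepsilon=\varnothing$). Put $\tilde\sigma(x)=1-e^{-\hat\sigma(x)}$ (with $e^{-\infty}=0$). Directional derivative. For $u:\mathrm{cl}\,G\to\mathbb{R}$, $x\in G$, $\bar f\in\mathbb{R}^d$, $$d^+u(x;\bar f)=\lim_{\rho\downarrow0}\ \sup\Bigl\{\tfrac{u(x+\delta f')-u(x)}{\delta}:\ (\delta,f')\in(0,\rho)\times\mathbb{R}^d,\ \|\bar f-f'\|\le\rho,\ x+\delta f'\in G\Bigr\}\in[-\infty,+\infty].$$ Subsolution. A subsolution of the Dirichlet problem in the claim is an upper semicontinuous function $u:\mathrm{cl}\,G\to\mathbb{R}$ such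 that (1) $u=\tilde\sigma$ on $\partial G$ and $\sup_{\mathrm{cl}\,G}|u|<\infty$; (2) $u$ is continuous at each point of $\partial G$; (3) for every $x\in G$ and $p\in P$, $\sup\{d^+u(x;\bar f)-\bar g:\ (\bar f,\bar g)\in E^-(x,u(x),p)\}\ge0$, where $E^-(x,z,p)=\mathrm{co}\{(f(x,p,q),\,g(x)(z-1)):\ q\in Q\}\subset\mathbb{R}^d\times\mathbb{R}$ and $\mathrm{co}$ denotes the convex hull. *)

theory Defs
  imports "HOL-Analysis.Analysis"
begin

(* Boundary of class C^0: up to a rotation, M is locally the region on or below the graph of a
   continuous function; e is the vertical direction and the orthogonal complement of e carries
   the remaining coordinates. *)
definition continuous_boundary :: "'a::euclidean_space set \<Rightarrow> bool" where
  "continuous_boundary M \<longleftrightarrow>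
     (\<forall>x\<in>frontier M. \<exists>U e. \<exists>\<phi>::'a \<Rightarrow> real.
        open U \<and> x \<in> U \<and> norm e = 1 \<and> continuous_on {y. y \<bullet> e = 0} \<phi> \<and>
        M \<inter> U = {y \<in> U. y \<bullet> e \<le> \<phi> (y - (y \<bullet> e) *\<^sub>R e)})"

definition min_over :: "'b set \<Rightarrow> ('b \<Rightarrow> real) \<Rightarrow> real" where
  "min_over A h = (LEAST m. m \<in> h ` A)"

definition max_over :: "'b set \<Rightarrow> ('b \<Rightarrow> real) \<Rightarrow> real" where
  "max_over A h = (GREATEST m. m \<in> h ` A)"

definition boundary_nbhd :: "real \<Rightarrow> 'a::euclidean_space set \<Rightarrow> 'a set" where
  "boundary_nbhd \<epsilon> M = {x + y | x y. x \<in> frontier M \<and> norm y \<le> \<epsilon>}"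

definition exp_neg :: "ennreal \<Rightarrow> real" where
  "exp_neg s = (if s = \<infinity> then 0 else exp (- enn2real s))"

definition upper_dir_quot ::
  "'a::euclidean_space set \<Rightarrow> ('a \<Rightarrow> real) \<Rightarrow> 'a \<Rightarrow> 'a \<Rightarrow> real \<Rightarrow> ereal" where
  "upper_dir_quot G u x fb \<rho> =
     Sup {ereal ((u (x + \<delta> *\<^sub>R f') - u x) / \<delta>) | \<delta> f'.
            0 < \<delta> \<and> \<delta> < \<rho> \<and> norm (fb - f') \<le> \<rho> \<and> x + \<delta> *\<^sub>R f' \<in> G}"

definition upper_dir_deriv ::
  "'a::euclidean_space set \<Rightarrow> ('a \<Rightarrow> real) \<Rightarrow> 'a \<Rightarrow> 'a \<Rightarrow> ereal" where
  "upper_dir_deriv G u x fb = Lim (at_right 0) (upper_dir_quot G u x fb)"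

(* The limit above always exists, so Lim is never applied to a divergent function. *)
lemma upper_dir_deriv_tendsto:
  "(upper_dir_quot G u x fb \<longlongrightarrow> upper_dir_deriv G u x fb) (at_right 0)"
proof -
  let ?h = "upper_dir_quot G u x fb"
  have mono: "?h r \<le> ?h s" if "r \<le> s" for r s
    unfolding upper_dir_quot_def using that by (intro Sup_subset_mono) force
  have "(?h \<longlongrightarrow> (INF r\<in>{0<..}. ?h r)) (at_right 0)"
  proof (rule decreasing_tendsto)
    show "\<forall>\<^sub>F r in at_right 0. (INF r\<in>{0<..}. ?h r) \<le> ?h r"
      by (rule eventually_at_rightI[of 0 1]) (auto intro: INF_lower)
  next
    fix a assume "(INF r\<in>{0<..}. ?h r) < a"
    then obtain s where s: "0 < s" "?h s < a"
      by (auto simp: INF_less_iff)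
    show "\<forall>\<^sub>F r in at_right 0. ?h r < a"
    proof (rule eventually_at_rightI[of 0 s])
      fix r assume "r \<in> {0<..<s}"
      then show "?h r < a" using mono[of r s] s by auto
    qed (use s in auto)
  qed
  then show ?thesis
    unfolding upper_dir_deriv_def by (simp add: tendsto_Lim)
qed

definition usc_on :: "'a::topological_space set \<Rightarrow> ('a \<Rightarrow> real) \<Rightarrow> bool" where
  "usc_on S u \<longleftrightarrow> (\<forall>x\<in>S. \<forall>a>u x. \<forall>\<^sub>F y in at x within S. u y < a)"

definition E_minus ::
  "('a::euclidean_space \<Rightarrow> 'p \<Rightarrow> 'q \<Rightarrow> 'a) \<Rightarrow> ('a \<Rightarrow> real) \<Rightarrow> 'q set \<Rightarrow>
     'a \<Rightarrow> real \<Rightarrow> 'p \<Rightarrow> ('a \<times> real) set" where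
  "E_minus f g Q x z p = convex hull {(f x p q, g x * (z - 1)) | q. q \<in> Q}"

(* Subsolutions of
     min_{p in P} max_{q in Q} <grad u(x), f(x,p,q)> + g(x) (1 - u(x)) = 0 in G,
     u = \<psi> on the boundary of G.
   Functions on the closure of G are total functions whose values elsewhere are irrelevant. *)
definition dirichlet_subsolution ::
  "('a::euclidean_space \<Rightarrow> 'p \<Rightarrow> 'q \<Rightarrow> 'a) \<Rightarrow> ('a \<Rightarrow> real) \<Rightarrow> 'p set \<Rightarrow> 'q set \<Rightarrow>
     'a set \<Rightarrow> ('a \<Rightarrow> real) \<Rightarrow> ('a \<Rightarrow> real) \<Rightarrow> bool" where
  "dirichlet_subsolution f g P Q G \<psi> u \<longleftrightarrow>
     usc_on (closure G) u \<and>
     (\<forall>x\<in>frontier G. u x = \<psi> x) \<and>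
     bdd_above ((\<lambda>x. \<bar>u x\<bar>) ` closure G) \<and>
     (\<forall>x\<in>frontier G. continuous (at x within closure G) u) \<and>
     (\<forall>x\<in>G. \<forall>p\<in>P.
        0 \<le> (SUP (fb, gb) \<in> E_minus f g Q x (u x) p. upper_dir_deriv G u x fb - ereal gb))"

end

theory Submission
  imports Defs
begin

text \<open>On \<open>closure G\<close> the function \<open>v\<close> is \<open>1 - exp_neg (\<sigma>h x)\<close>. It takes its maximum \<open>1\<close> on the closed
  set \<open>boundary_nbhd \<epsilon> M2\<close> and is continuous off it, so it is upper semicontinuous. A boundary point
  lies either on \<open>frontier M2\<close>, near which \<open>v\<close> is constant, or on \<open>frontier M1\<close>, where \<open>\<sigma>h\<close> is
  finite, hence off \<open>boundary_nbhd \<epsilon> M2\<close>. For the differential inequality, the pair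
  \<open>(f x p q0, g x * (v x - 1))\<close> of \<open>E_minus\<close> is already good enough because \<open>b \<le> g x\<close>.\<close>

text \<open>The set is the Minkowski sum of a closed set and a compact ball, and such sums are
  closed.\<close>

lemma closed_boundary_nbhd: "closed (boundary_nbhd \<epsilon> M)"
proof -
  have "boundary_nbhd \<epsilon> M = (\<Union>x\<in>frontier M. \<Union>y\<in>cball 0 \<epsilon>. {x + y})"
    unfolding boundary_nbhd_def by fastforce
  then show ?thesis
    using closed_compact_sums[OF frontier_closed compact_cball] by metis
qed

lemma cball_subset_boundary_nbhd:
  assumes "x \<in> frontier M"
  shows "cball x \<epsilon> \<subseteq> boundary_nbhd \<epsilon> M"
proof
  fix y assume "y \<in> cball x \<epsilon>"
  then have "y = x + (y - x)" "norm (y - x) \<le> \<epsilon>"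
    by (auto simp: dist_norm norm_minus_commute)
  then show "y \<in> boundary_nbhd \<epsilon> M"
    unfolding boundary_nbhd_def using assms by blast
qed

lemma exp_neg_bounds: "0 \<le> exp_neg s" "exp_neg s \<le> 1"
  unfolding exp_neg_def by auto

text \<open>At a point of \<open>B\<close> the value is a maximum over \<open>S\<close>, so any
  larger \<open>a\<close> bounds \<open>u\<close> on all of \<open>S\<close>; at the other points
  continuity gives the bound locally.\<close>

lemma usc_on_max_off_open:
  fixes u :: "'a::t2_space \<Rightarrow> real"
  assumes "\<And>x y. x \<in> S \<inter> B \<Longrightarrow> y \<in> S \<Longrightarrow> u y \<le> u x"
    and "\<And>x. x \<in> S - B \<Longrightarrow> continuous (at x within S) u"
  shows "usc_on S u"
  unfolding usc_on_def
proof (intro ballI allI impI)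
  fix x a assume x: "x \<in> S" and a: "a > u x"
  show "\<forall>\<^sub>F y in at x within S. u y < a"
  proof (cases "x \<in> B")
    case True
    then have "u y < a" if "y \<in> S" for y
      using assms(1)[of x y] x a that by auto
    then show ?thesis
      by (auto simp: eventually_at_filter)
  next
    case False
    then have "(u \<longlongrightarrow> u x) (at x within S)"
      using assms(2) x by (simp add: continuous_within)
    then show ?thesis
      using a by (rule order_tendstoD(2))
  qed
qed

text \<open>Continuity is local: the open set \<open>- B\<close> is a neighbourhood of
  \<open>x\<close>, so removing \<open>B\<close> from \<open>S\<close> leaves the filter at
  \<open>x\<close> unchanged.\<close>

lemma continuous_within_closed_complement:
  fixes B :: "'a::t2_space set"
  assumes "closed B" "x \<in> S - B" "continuous_on (S - B) u"
  shows "continuous (at x within S) u"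
proof -
  have "at x within S = at x within (S - B)"
    using assms by (intro at_within_nhd[of x "- B"]) auto
  moreover have "continuous (at x within (S - B)) u"
    using assms by (simp add: continuous_on_eq_continuous_within)
  ultimately show ?thesis
    by (simp add: continuous_within)
qed

lemma E_minus_generator:
  assumes "q \<in> Q"
  shows "(f x p q, g x * (z - 1)) \<in> E_minus f g Q x z p"
  unfolding E_minus_def using assms by (intro hull_inc) blast

theorem proposition2:
  fixes P :: "'p::topological_space set" and Q :: "'q::topological_space set"
    and M1 M2 G :: "'a::euclidean_space set"
    and f :: "'a \<Rightarrow> 'p \<Rightarrow> 'q \<Rightarrow> 'a" and g :: "'a \<Rightarrow> real"
    and \<sigma> \<sigma>h :: "'a \<Rightarrow> ennreal"
    and v :: "'a \<Rightarrow> real"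
    and Rf lam b S L \<epsilon> :: real
  assumes P: "compact P" "P \<noteq> {}" and Q: "compact Q" "Q \<noteq> {}"
    and M1: "closed M1" "continuous_boundary M1"
    and M2: "closed M2" "continuous_boundary M2"
    and dist_pos: "M1 = {} \<or> M2 = {} \<or> 0 < setdist M1 M2"
    and G: "G = - (M1 \<union> M2)"
    and A1_cont: "continuous_on (UNIV \<times> P \<times> Q) (\<lambda>(x, p, q). f x p q)" "continuous_on UNIV g"
    and A1_growth: "\<And>x p q. p \<in> P \<Longrightarrow> q \<in> Q \<Longrightarrow> norm (f x p q) \<le> Rf * (1 + norm x)"
    and A2: "\<And>x y p q. p \<in> P \<Longrightarrow> q \<in> Q \<Longrightarrow>
               norm (f (x + y) p q - f x p q) + \<bar>g (x + y) - g x\<bar> \<le> lam * norm y"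
    and A3: "\<And>s x. min_over P (\<lambda>p. max_over Q (\<lambda>q. s \<bullet> f x p q))
                  = max_over Q (\<lambda>q. min_over P (\<lambda>p. s \<bullet> f x p q))"
    and A4: "0 < b" "\<And>x. b \<le> g x"
    and A5: "0 < S" "\<And>x. x \<in> frontier M1 \<Longrightarrow> \<sigma> x \<le> ennreal S"
            "\<And>x. x \<in> frontier M2 \<Longrightarrow> \<sigma> x = \<infinity>"
            "L-lipschitz_on (frontier M1) (\<lambda>x. enn2real (\<sigma> x))"
    and eps: "0 < \<epsilon>"
    and ext_M1: "\<And>x. x \<in> frontier M1 \<Longrightarrow> \<sigma>h x = \<sigma> x"
    and ext_off: "\<And>x. x \<in> closure G - boundary_nbhd \<epsilon> M2 \<Longrightarrow> \<sigma>h x \<le> ennreal S"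
                 "\<exists>K. K-lipschitz_on (closure G - boundary_nbhd \<epsilon> M2) (\<lambda>x. enn2real (\<sigma>h x))"
    and ext_M2: "\<And>x. x \<in> closure G \<inter> boundary_nbhd \<epsilon> M2 \<Longrightarrow> \<sigma>h x = \<infinity>"
    and v: "\<And>x. x \<in> closure G \<Longrightarrow>
              v x = (if x \<in> boundary_nbhd \<epsilon> M2 then 1 else 1 - exp_neg (\<sigma>h x))"
    and decr: "\<And>x0 p. x0 \<in> G \<Longrightarrow> p \<in> P \<Longrightarrow>
                 \<exists>q0\<in>Q. ereal (b * (1 - v x0)) \<ge> - upper_dir_deriv G v x0 (f x0 p q0)"
  shows "dirichlet_subsolution f g P Q G (\<lambda>x. 1 - exp_neg (\<sigma>h x)) v"
proof -
  let ?B = "boundary_nbhd \<epsilon> M2"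
  have G_closure: "x \<in> closure G" if "x \<in> G" for x
    using that closure_subset by blast
  have frontier_closure: "x \<in> closure G" if "x \<in> frontier G" for x
    using that by (simp add: frontier_def)
  \<comment> \<open>The two branches of \<open>v\<close> agree in form, since
    \<open>\<sigma>h\<close> is infinite on \<open>?B\<close> and \<open>exp_neg\<close> vanishes at
    infinity.\<close>
  have v_eq: "v x = 1 - exp_neg (\<sigma>h x)" if "x \<in> closure G" for x
    using v[OF that] ext_M2[of x] that by (auto simp: exp_neg_def)
  have v_bounds: "0 \<le> v x" "v x \<le> 1" if "x \<in> closure G" for x
    using v_eq[OF that] exp_neg_bounds[of "\<sigma>h x"] by auto
  have v_cont: "continuous_on (closure G - ?B) v"
  proof -
    obtain K where "K-lipschitz_on (closure G - ?B) (\<lambda>x. enn2real (\<sigma>h x))"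
      using ext_off(2) by blast
    then have "continuous_on (closure G - ?B) (\<lambda>x. 1 - exp (- enn2real (\<sigma>h x)))"
      by (intro continuous_intros) (rule lipschitz_on_continuous_on)
    moreover have "v x = 1 - exp (- enn2real (\<sigma>h x))" if "x \<in> closure G - ?B" for x
    proof -
      \<comment> \<open>Finiteness selects the exponential branch of \<open>exp_neg\<close> and
        rules out the default value 0 that \<open>enn2real\<close> takes at infinity.\<close>
      have "\<sigma>h x \<noteq> \<infinity>"
        using ext_off(1)[OF that] by (auto simp: top_unique)
      then show ?thesis
        using v_eq[of x] that by (simp add: exp_neg_def)
    qed
    ultimately show ?thesis
      by (metis (no_types, lifting) continuous_on_cong)
  qed
  have v_cont_at: "continuous (at x within closure G) v" if "x \<in> closure G - ?B" for x
    using closed_boundary_nbhd that v_cont by (rule continuous_within_closed_complement)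

  show ?thesis
    unfolding dirichlet_subsolution_def
  proof (intro conjI ballI)
    show "usc_on (closure G) v"
    proof (rule usc_on_max_off_open[where B = ?B])
      fix x y assume "x \<in> closure G \<inter> ?B" "y \<in> closure G"
      then show "v y \<le> v x"
        using v[of x] v_bounds[of y] by simp
    qed (rule v_cont_at)
    show "v x = 1 - exp_neg (\<sigma>h x)" if "x \<in> frontier G" for x
      using v_eq[OF frontier_closure[OF that]] .
    show "bdd_above ((\<lambda>x. \<bar>v x\<bar>) ` closure G)"
      using v_bounds by (intro bdd_aboveI[of _ 1]) auto
    show "continuous (at x within closure G) v" if x: "x \<in> frontier G" for x
    proof (cases "x \<in> frontier M2")
      \<comment> \<open>The whole \<open>\<epsilon>\<close>-ball around \<open>x\<close> lies in
        \<open>?B\<close>, so \<open>v\<close> is constantly 1 on its part in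
        \<open>closure G\<close>.\<close>
      case True
      have "\<forall>\<^sub>F y in at x within closure G. y \<in> ball x \<epsilon> \<and> y \<in> closure G"
        unfolding eventually_at using eps by (intro exI[of _ \<epsilon>]) (auto simp: dist_commute)
      then have "\<forall>\<^sub>F y in at x within closure G. v y = v x"
      proof eventually_elim
        case (elim y)
        have "y \<in> ?B" "x \<in> ?B"
          using cball_subset_boundary_nbhd[OF True, of \<epsilon>] elim eps by auto
        then show ?case
          using v elim frontier_closure[OF x] by simp
      qed
      then show ?thesis
        by (simp add: continuous_within tendsto_eventually)
    next
      case False
      \<comment> \<open>Only \<open>frontier M1\<close> remains, where \<open>\<sigma>h\<close>
        equals the bounded \<open>\<sigma>\<close>; on \<open>?B\<close> it would be
        infinite.\<close>
      have "x \<in> frontier M1 \<union> frontier M2"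
        using x frontier_Un_subset[of M1 M2] unfolding G frontier_complement by blast
      then have "\<sigma>h x \<le> ennreal S"
        using False ext_M1 A5(2) by simp
      then have "x \<notin> ?B"
        using ext_M2[of x] frontier_closure[OF x] by (auto simp: top_unique)
      then show ?thesis
        using v_cont_at frontier_closure[OF x] by blast
    qed
    fix x p assume x: "x \<in> G" and p: "p \<in> P"
    obtain q where q: "q \<in> Q"
      and d: "- upper_dir_deriv G v x (f x p q) \<le> ereal (b * (1 - v x))"
      using decr[OF x p] by blast
    \<comment> \<open>The bound \<open>v x \<le> 1\<close> makes the factor nonnegative, so
      \<open>b\<close> may be raised to \<open>g x\<close>.\<close>
    have "b * (1 - v x) \<le> g x * (1 - v x)"
      using A4(2) v_bounds(2)[OF G_closure[OF x]] by (intro mult_right_mono) auto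
    then have "b * (1 - v x) \<le> - (g x * (v x - 1))"
      by (simp add: algebra_simps)
    \<comment> \<open>The derivative may be infinite: \<open>d\<close> excludes minus infinity, and
      plus infinity makes the claim trivial.\<close>
    then have "0 \<le> upper_dir_deriv G v x (f x p q) - ereal (g x * (v x - 1))"
      using d by (cases "upper_dir_deriv G v x (f x p q)") auto
    \<comment> \<open>A single generator of the convex hull already bounds the supremum from
      below.\<close>
    also have "\<dots> \<le> (SUP (fb, gb) \<in> E_minus f g Q x (v x) p. upper_dir_deriv G v x fb - ereal gb)"
      by (rule SUP_upper2[OF E_minus_generator[OF q]]) simp
    finally show "0 \<le> (SUP (fb, gb) \<in> E_minus f g Q x (v x) p. upper_dir_deriv G v x fb - ereal gb)" .
  qed
qed

end
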